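(* Let $S$ be a finite set such that $s=|S|\ge 3$. A hypercompletely separating system $\mathscr{A}$ defined on $S$ is size-minimal if and only if $|\mathscr{A}|=\left\lceil\frac{1+\sqrt{8s+1}}{2}\right\rceil$.
   Context: A system on a non-empty finite set $S$ is any set $\mathscr{A}$ of subsets of $S$, i.e. $\mathscr{A}\subseteq\mathcal{P}(S)$, where $\mathcal{P}(S)$ is the power set of $S$. A system $\mathscr{A}$ on $S$ is hypercompletely separating if for each $a\in S$ there are $A,B\in\mathscr{A}$ such that $A\cap B=\{a\}$; here $A=B$ is allowed (in which case $A=B=\{a\}$). A hypercompletely separating system $\mathscr{A}$ on $S$ is size-minimal if $|\mathscr{A}|\le|\mathscr{B}|$ for every hypercompletely separating system $\mathscr{B}$ on $S$. *)

theory Defs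
  imports Complex_Main
begin

definition set_system :: "'a set \<Rightarrow> 'a set set \<Rightarrow> bool" where
  "set_system S \<A> \<longleftrightarrow> finite S \<and> S \<noteq> {} \<and> \<A> \<subseteq> Pow S"

(* A = B is allowed, in which case A = B = {a}. *)
definition hypercompletely_separating :: "'a set \<Rightarrow> 'a set set \<Rightarrow> bool" where
  "hypercompletely_separating S \<A> \<longleftrightarrow>
     set_system S \<A> \<and> (\<forall>a\<in>S. \<exists>A\<in>\<A>. \<exists>B\<in>\<A>. A \<inter> B = {a})"

(* The systems compared are all on the same ground set S; they are finite because S is, so card
   is their true size. *)
definition size_minimal :: "'a set \<Rightarrow> 'a set set \<Rightarrow> bool" where
  "size_minimal S \<A> \<longleftrightarrow>
     hypercompletely_separating S \<A> \<and>
     (\<forall>\<B>. hypercompletely_separating S \<B> \<longrightarrow> card \<A> \<le> card \<B>)"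

end

theory Submission
  imports Defs
begin

text \<open>
  Each point of the ground set is either a singleton member of the system or is determined by an
  unordered pair of members that are not singletons, since a singleton \<open>{x}\<close> can only contribute the
  point \<open>x\<close>. With \<open>k\<close> singletons among \<open>n\<close> members this gives
  \<open>s \<le> k + (n - k choose 2)\<close>, which is at most \<open>n choose 2\<close> once \<open>s \<ge> 3\<close>. Conversely, if
  \<open>s \<le> (n choose 2)\<close>, label the points injectively by two-element subsets of \<open>{0..<n}\<close> and let
  the \<open>i\<close>-th member consist of the points whose label contains \<open>i\<close>. The ceiling in the theorem is
  the least \<open>n\<close> with \<open>s \<le> (n choose 2)\<close>.
\<close>

text \<open>A pair from a disjoint union lies within one part or joins the two; the cross term
  \<open>k * l\<close> later absorbs the singleton members.\<close>

lemma add_choose_two: "(k + l) choose 2 = (k choose 2) + (l choose 2) + k * l"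
  by (induction k) (simp_all add: numeral_2_eq_2)

lemma le_choose_two_if_ge_3: "n \<ge> 3 \<Longrightarrow> n \<le> n choose 2"
  by (induction n rule: dec_induct) (simp_all add: numeral_2_eq_2 numeral_3_eq_3)

text \<open>\<open>8 * (m choose 2) + 1\<close> is the square of \<open>2 * m - 1\<close>, which is
  positive for \<open>m \<ge> 1\<close>, so the square root can be compared by squaring.\<close>

lemma ceiling_le_iff_le_choose_two:
  assumes "m \<ge> 1"
  shows "\<lceil>(1 + sqrt (8 * real s + 1)) / 2\<rceil> \<le> int m \<longleftrightarrow> s \<le> m choose 2"
proof -
  have "even (m * (m - 1))"
    using assms by auto
  then have choose: "m * (m - 1) = 2 * (m choose 2)"
    by (simp add: choose_two)
  have "real m * (real m - 1) = real (m * (m - 1))"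
    using assms by (simp add: of_nat_diff)
  then have sq: "(2 * real m - 1)\<^sup>2 = 8 * real (m choose 2) + 1"
    unfolding choose by (simp add: power2_eq_square algebra_simps)
  have "\<lceil>(1 + sqrt (8 * real s + 1)) / 2\<rceil> \<le> int m \<longleftrightarrow> sqrt (8 * real s + 1) \<le> 2 * real m - 1"
    by (simp add: ceiling_le_iff field_simps)
  also have "\<dots> \<longleftrightarrow> 8 * real s + 1 \<le> (2 * real m - 1)\<^sup>2"
    using assms real_sqrt_le_iff[of "8 * real s + 1" "(2 * real m - 1)\<^sup>2"] by simp
  also have "\<dots> \<longleftrightarrow> s \<le> m choose 2"
    unfolding sq by simp
  finally show ?thesis .
qed

lemma card_le_choose_two_if_hypercompletely_separating:
  assumes hcs: "hypercompletely_separating S \<A>" and "card S \<ge> 3"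
  shows "card S \<le> card \<A> choose 2"
proof -
  define K where "K = {A \<in> \<A>. is_singleton A}"
  define L where "L = \<A> - K"
  define P where "P = {X. X \<subseteq> L \<and> card X = 2}"
  have "finite \<A>"
    using hcs finite_subset[of \<A> "Pow S"]
    by (simp add: hypercompletely_separating_def set_system_def)
  then have fin: "finite K" "finite L" "finite P"
    by (simp_all add: K_def L_def P_def)
  have "\<A> = K \<union> L" "K \<inter> L = {}"
    by (auto simp: K_def L_def)
  then have card_A: "card \<A> = card K + card L"
    using fin by (simp add: card_Un_disjoint)
  \<comment> \<open>For pairs whose intersection is not a singleton, \<open>the_elem\<close> is
    unspecified; this is harmless, as only an upper bound on the number of values is needed.\<close>
  have "S \<subseteq> the_elem ` K \<union> (\<lambda>X. the_elem (\<Inter>X)) ` P"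
  proof
    fix a assume "a \<in> S"
    then obtain A B where AB: "A \<in> \<A>" "B \<in> \<A>" "A \<inter> B = {a}"
      using hcs by (auto simp: hypercompletely_separating_def)
    show "a \<in> the_elem ` K \<union> (\<lambda>X. the_elem (\<Inter>X)) ` P"
    proof (cases "{a} \<in> K")
      case True
      then show ?thesis
        by (metis UnI1 imageI the_elem_eq)
    next
      case False
      \<comment> \<open>Both \<open>A\<close> and \<open>B\<close> contain \<open>a\<close>, so a
        singleton among them would be \<open>{a}\<close>, which is excluded in this case.\<close>
      have not_K: "C \<notin> K" if "C \<in> {A, B}" for C
      proof
        assume "C \<in> K"
        moreover from this obtain c where "C = {c}"
          by (auto simp: K_def is_singleton_def)
        ultimately show False
          using that AB False by auto
      qed
      have "A \<noteq> B"
        using AB False by (auto simp: K_def)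
      then have "{A, B} \<in> P"
        using AB not_K by (simp add: P_def L_def)
      moreover have "a = the_elem (\<Inter>{A, B})"
        using AB by simp
      ultimately show ?thesis
        by blast
    qed
  qed
  then have "card S \<le> card (the_elem ` K \<union> (\<lambda>X. the_elem (\<Inter>X)) ` P)"
    using fin by (intro card_mono) auto
  also have "\<dots> \<le> card K + card P"
    using fin by (intro order.trans[OF card_Un_le] add_mono card_image_le)
  also have "card P = card L choose 2"
    unfolding P_def using fin by (intro n_subsets)
  finally have bound: "card S \<le> card K + (card L choose 2)" .
  show ?thesis
  \<comment> \<open>Without non-singletons the cross term vanishes, and
    \<open>card K \<ge> 3\<close> is what gives \<open>card K \<le> card K choose 2\<close>.\<close>
  proof (cases "card L = 0")
    case True
    then show ?thesis
      using bound card_A assms(2) le_choose_two_if_ge_3[of "card K"] by (simp add: numeral_2_eq_2)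
  next
    case False
    then have "card K \<le> card K * card L"
      by simp
    then show ?thesis
      using bound unfolding card_A add_choose_two by linarith
  qed
qed

lemma exists_hypercompletely_separating:
  assumes "finite S" "S \<noteq> {}" "card S \<le> n choose 2"
  obtains \<B> where "hypercompletely_separating S \<B>" "card \<B> \<le> n"
proof -
  define P where "P = {X. X \<subseteq> {..<n} \<and> card X = 2}"
  have "card P = n choose 2"
    unfolding P_def by (simp add: n_subsets)
  moreover have "finite P"
    by (simp add: P_def)
  ultimately obtain f where f: "f ` S \<subseteq> P" "inj_on f S"
    using card_le_inj[of S P] assms by auto
  define F where "F i = {a \<in> S. i \<in> f a}" for i
  have "\<exists>A\<in>F ` {..<n}. \<exists>B\<in>F ` {..<n}. A \<inter> B = {a}" if a: "a \<in> S" for a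
  proof -
    from a f(1) have "f a \<in> P"
      by auto
    then obtain i j where ij: "f a = {i, j}" "i < n" "j < n"
      by (auto simp: P_def card_2_iff)
    have "b = a" if b: "b \<in> F i \<inter> F j" for b
    proof -
      \<comment> \<open>Labels all have size two, so inclusion between them forces equality, and
        injectivity of \<open>f\<close> then identifies the points.\<close>
      have "f a \<subseteq> f b" "b \<in> S"
        using b ij by (auto simp: F_def)
      moreover from this f(1) have "f b \<in> P"
        by auto
      moreover note \<open>f a \<in> P\<close>
      ultimately have "f a = f b"
        using finite_subset[of "f b" "{..<n}"]
        by (intro card_subset_eq) (auto simp: P_def)
      then show ?thesis
        using f(2) a \<open>b \<in> S\<close> by (auto dest: inj_onD)
    qed
    moreover have "a \<in> F i \<inter> F j"
      using a ij by (simp add: F_def)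
    ultimately have "F i \<inter> F j = {a}"
      by blast
    then show ?thesis
      using ij by blast
  qed
  then have "hypercompletely_separating S (F ` {..<n})"
    using assms by (auto simp: hypercompletely_separating_def set_system_def F_def)
  \<comment> \<open>Equality can fail: all indices that occur in no label yield the empty
    member.\<close>
  moreover have "card (F ` {..<n}) \<le> n"
    using card_image_le[of "{..<n}" F] by simp
  ultimately show ?thesis
    by (rule that)
qed

theorem theorem4p1:
  fixes S :: "'a set" and \<A> :: "'a set set"
  assumes "finite S" and "card S \<ge> 3"
    and "hypercompletely_separating S \<A>"
  shows "size_minimal S \<A> \<longleftrightarrow>
    int (card \<A>) = \<lceil>(1 + sqrt (8 * real (card S) + 1)) / 2\<rceil>"
proof -
  define c where "c = \<lceil>(1 + sqrt (8 * real (card S) + 1)) / 2\<rceil>"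
  have "c > 0"
    unfolding c_def zero_less_ceiling by (simp add: add_pos_nonneg)
  then have c: "nat c \<ge> 1" "int (nat c) = c"
    by simp_all
  have lower: "c \<le> int (card \<B>)" if "hypercompletely_separating S \<B>" for \<B>
  proof -
    have "card S \<le> card \<B> choose 2"
      using that assms(2) by (rule card_le_choose_two_if_hypercompletely_separating)
    moreover from this assms(2) have "card \<B> \<noteq> 0"
      by (intro notI) (simp add: numeral_2_eq_2)
    ultimately show ?thesis
      unfolding c_def by (simp add: ceiling_le_iff_le_choose_two)
  qed
  \<comment> \<open>The equivalence is taken at \<open>m = nat c\<close>, where its left side reads
    \<open>c \<le> c\<close>.\<close>
  have "card S \<le> nat c choose 2"
    using ceiling_le_iff_le_choose_two[OF c(1), of "card S"] c(2) by (simp add: c_def)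
  moreover have "S \<noteq> {}"
    using assms(2) by auto
  ultimately obtain \<B> where \<B>: "hypercompletely_separating S \<B>" "card \<B> \<le> nat c"
    using exists_hypercompletely_separating assms(1) by metis
  have "size_minimal S \<A> \<longleftrightarrow> int (card \<A>) = c"
  proof
    assume "size_minimal S \<A>"
    then have "card \<A> \<le> nat c"
      using \<B> by (force simp: size_minimal_def)
    then show "int (card \<A>) = c"
      using lower[OF assms(3)] c(2) by linarith
  next
    assume "int (card \<A>) = c"
    then show "size_minimal S \<A>"
      using lower assms(3) by (force simp: size_minimal_def)
  qed
  then show ?thesis
    by (simp add: c_def)
qed

end
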